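(* Let $F[u]_{t,\boldsymbol x}=0$ ($t\in\mathcal I$, $\boldsymbol x\in\Omega$) be a scalar PDE of order $d$ for one unknown $u$. Let $u\in C^{\max(p,q)+\max(r,d)}(\overline{\mathcal I\times\Omega})$ and let $\lambda$ be an ($r$-th order) conservation law multiplier of the PDE with corresponding density $\psi$ and fluxes $\boldsymbol\phi=(\phi^1,\dots,\phi^n)$. Suppose $\lambda^{\tau,h}$, $D_t^{\tau,h}\psi$ and $D_{\boldsymbol x}^{\tau,h}\cdot\boldsymbol\phi$ are finite difference discretizations of $\lambda$, $D_t\psi$ and $D_{\boldsymbol x}\cdot\boldsymbol\phi$ with accuracy up to order $p$ in space and $q$ in time: $$\|\lambda[u]-\lambda^{\tau,h}\{u\}\|_{l^\infty(\mathcal I^\tau\times\Omega^h)}\le C_\lambda(h^p+\tau^q),$$ $$\|D_t\psi[u]-D_t^{\tau,h}\psi\{u\}\|_{l^\infty(\mathcal I^\tau\times\Omega^h)}\le C_t(h^p+\tau^q),$$ $$\|D_{\boldsymbol x}\cdot\boldsymbol\phi[u]-D_{\boldsymbol x}^{\tau,h}\cdot\boldsymbol\phi\{u\}\|_{l^\infty(\mathcal I^\tau\times\Omega^h)}\le C_x(h^p+\tau^q).$$ Let $u^{\tau,h}:\mathcal I^\tau\times\Omega^h\to\mathbb R$ be a discrete scalar function. Suppose $(\lambda^{\tau,h})^{-1}\{u^{\tau,h}\}$, the multiplicative inverse of $\lambda^{\tau,h}\{u^{\tau,h}\}$, exists on $\mathcal I^\tau\times\Omega^h$ and that $\|(\lambda^{\tau,h})^{-1}\{u^{\tau,h}\}\|_{l^\infty(\mathcal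 I^\tau\times\Omega^h)}\le\gamma<\infty$, with $\gamma$ independent of $\tau,h$. Define the finite difference discretization of $F$ as $$F^{\tau,h}\{u^{\tau,h}\}:=(\lambda^{\tau,h})^{-1}\{u^{\tau,h}\}\left(D_t^{\tau,h}\psi\{u^{\tau,h}\}+D_{\boldsymbol x}^{\tau,h}\cdot\boldsymbol\phi\{u^{\tau,h}\}\right).$$ Then there exists a constant $C>0$ independent of $h,\tau$ such that $$\|F[u]-F^{\tau,h}\{u\}\|_{l^\infty(\mathcal I^\tau\times\Omega^h)}\le C(h^p+\tau^q).$$
   Context: $\mathcal I=(0,T)$; $\Omega\subset\mathbb R^n$ is a bounded domain. $F[u]_{t,\boldsymbol x}$ denotes the value at $(t,\boldsymbol x)$ of a function (continuous in its arguments) of $t,\boldsymbol x,u$ and the partial derivatives of $u$ in $t,\boldsymbol x$ up to order $d$; similarly for other differential functions, subscripts being omitted when the point is clear. $D_t$, $D_{x_i}$ are total derivatives and $D_{\boldsymbol x}\cdot\boldsymbol\phi=\sum_{i=1}^nD_{x_i}\phi^i$. An analytic function $\lambda$ of $t,\boldsymbol x,u$ and derivatives of $u$ up to order $r$ is an $r$-th order conservation law multiplier of $F$ with (analytic) density $\psi$ and fluxes $\boldsymbol\phi$, depending on derivatives of order at most $\max(r,d)-1$, if $\lambda[u]_{t,\boldsymbol x}F[u]_{t,\boldsymbol x}=D_t\psi[u]_{t,\boldsymbol x}+D_{\boldsymbol x}\cdot\boldsymbol\phi[u]_{t,\boldsymbol x}$ holds identically (not only on solutions). Mesh: $\mathcal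 I^\tau=\{k\tau:k=0,\dots,\lfloor T/\tau\rfloor\}$ with time step $\tau$, and $\Omega^h=\Omega\cap h\mathbb Z^n$ with mesh size $h$, with points $t_k$, $\boldsymbol x_J$. A finite difference discretization $A^{\tau,h}$ is an expression whose value at $(t_k,\boldsymbol x_J)$ depends on $t_k,\boldsymbol x_J$ and mesh values of its argument: $A^{\tau,h}\{u^{\tau,h}\}$ is evaluated on the values of a discrete function $u^{\tau,h}$, and $A^{\tau,h}\{u\}$, for a continuous function $u$ on $\overline{\mathcal I\times\Omega}$, is the same expression evaluated on the mesh values $u(t_k,\boldsymbol x_J)$. $\|\cdot\|_{l^\infty(\mathcal I^\tau\times\Omega^h)}$ is the maximum over mesh points. The constants $C_\lambda,C_t,C_x$ do not depend on $\tau,h$. *)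

theory Defs
  imports "HOL-Analysis.Analysis" "HOL-Library.Multiset"
begin

(* The independent variables are indexed by 'n option: None is time and Some i is the i-th
   space coordinate. A partial derivative is indexed by the multiset of the variables with
   respect to which one differentiates, so that size \<alpha> is its order and {#} stands for u itself. *)

type_synonym 'n spacetime = "real \<times> (real ^ 'n)"
type_synonym 'n jet = "'n spacetime \<times> ('n option multiset \<Rightarrow> real)"

definition dir :: "'n::finite option \<Rightarrow> 'n spacetime" where
  "dir i = (case i of None \<Rightarrow> (1, 0) | Some j \<Rightarrow> (0, axis j 1))"


section \<open>Partial derivatives up to the boundary\<close>

definition partial :: "'n::finite option \<Rightarrow> ('n spacetime \<Rightarrow> real) \<Rightarrow> 'n spacetime \<Rightarrow> real" where
  "partial i f z = deriv (\<lambda>s. f (z + s *\<^sub>R dir i)) 0"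

primrec partials :: "'n::finite option list \<Rightarrow> ('n spacetime \<Rightarrow> real) \<Rightarrow> 'n spacetime \<Rightarrow> real" where
  "partials [] f = f"
| "partials (i # is) f = partial i (partials is f)"

(* u is of class C^k on the closure of the open set S: all partial derivatives of order at most k
   exist in S and extend continuously to the closure; u is its own extension. *)
definition Ck_closure :: "nat \<Rightarrow> 'n::finite spacetime set \<Rightarrow> ('n spacetime \<Rightarrow> real) \<Rightarrow> bool" where
  "Ck_closure k S u \<longleftrightarrow>
     continuous_on (closure S) u \<and>
     (\<forall>is i. length is < k \<longrightarrow>
        (\<forall>z\<in>S. (\<lambda>s. partials is u (z + s *\<^sub>R dir i)) differentiable (at 0))) \<and>
     (\<forall>is. length is \<le> k \<longrightarrow>
        (\<exists>g. continuous_on (closure S) g \<and> (\<forall>z\<in>S. g z = partials is u z)))"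

(* At a boundary point this is the value of the continuous extension. For functions of class C^k
   and size \<alpha> \<le> k the chosen order of differentiation is immaterial. *)
definition partial_closure ::
    "'n::finite spacetime set \<Rightarrow> 'n option multiset \<Rightarrow> ('n spacetime \<Rightarrow> real) \<Rightarrow> 'n spacetime \<Rightarrow> real"
  where "partial_closure S \<alpha> u z = Lim (at z within S) (partials (SOME is. mset is = \<alpha>) u)"

definition jet_of :: "'n::finite spacetime set \<Rightarrow> ('n spacetime \<Rightarrow> real) \<Rightarrow> 'n spacetime \<Rightarrow> 'n jet"
  where "jet_of S u z = (z, \<lambda>\<alpha>. partial_closure S \<alpha> u z)"


section \<open>Differential functions and total derivatives\<close>

(* A differential function is a function f on the jet space; f[u] at z is f (jet_of S u z). *)

definition jet_order_le :: "nat \<Rightarrow> ('n::finite jet \<Rightarrow> real) \<Rightarrow> bool" where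
  "jet_order_le k f \<longleftrightarrow>
     (\<forall>z j j'. (\<forall>\<alpha>. size \<alpha> \<le> k \<longrightarrow> j \<alpha> = j' \<alpha>) \<longrightarrow> f (z, j) = f (z, j'))"

definition pde_of_order :: "nat \<Rightarrow> 'n::finite spacetime set \<Rightarrow> ('n jet \<Rightarrow> real) \<Rightarrow> bool" where
  "pde_of_order d Z F \<longleftrightarrow> jet_order_le d F \<and> continuous_on (Z \<times> UNIV) F"

definition jet_coord :: "'n::finite jet \<Rightarrow> 'n option + 'n option multiset \<Rightarrow> real" where
  "jet_coord w c = (case c of
      Inl None \<Rightarrow> fst (fst w)
    | Inl (Some i) \<Rightarrow> snd (fst w) $ i
    | Inr \<alpha> \<Rightarrow> snd w \<alpha>)"

definition coords_upto :: "nat \<Rightarrow> ('n::finite option + 'n option multiset) set" where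
  "coords_upto k = range Inl \<union> Inr ` {\<alpha>. size \<alpha> \<le> k}"

lemma finite_size_le: "finite {\<alpha> :: 'a::finite multiset. size \<alpha> \<le> k}"
proof -
  have "{\<alpha> :: 'a multiset. size \<alpha> \<le> k} = (\<Union>n\<le>k. multisets_of_size UNIV n)"
    by (auto simp: multisets_of_size_def)
  then show ?thesis by auto
qed

lemma finite_coords_upto: "finite (coords_upto k)"
  by (simp add: coords_upto_def finite_size_le)

(* Real analyticity at w0 in the finitely many coordinates up to order k: near w0, f is the sum of
   an (absolutely convergent) power series; a monomial is a multiset m of coordinates. *)
definition real_analytic_at :: "nat \<Rightarrow> ('n::finite jet \<Rightarrow> real) \<Rightarrow> 'n jet \<Rightarrow> bool" where
  "real_analytic_at k f w0 \<longleftrightarrow>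
     (\<exists>a \<epsilon>. \<epsilon> > 0 \<and>
       (\<forall>w. (\<forall>c\<in>coords_upto k. \<bar>jet_coord w c - jet_coord w0 c\<bar> < \<epsilon>) \<longrightarrow>
         ((\<lambda>m. a m * (\<Prod>c\<in>#m. jet_coord w c - jet_coord w0 c)) has_sum f w)
           {m. set_mset m \<subseteq> coords_upto k}))"

definition analytic_diff_fun :: "nat \<Rightarrow> 'n::finite spacetime set \<Rightarrow> ('n jet \<Rightarrow> real) \<Rightarrow> bool" where
  "analytic_diff_fun k Z f \<longleftrightarrow> jet_order_le k f \<and> (\<forall>w \<in> Z \<times> UNIV. real_analytic_at k f w)"

(* k has to bound the order of f; a larger bound gives the same value. *)
definition total_deriv ::
    "nat \<Rightarrow> 'n::finite option \<Rightarrow> ('n jet \<Rightarrow> real) \<Rightarrow> 'n jet \<Rightarrow> real" where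
  "total_deriv k i f w = (case w of (z, j) \<Rightarrow>
     deriv (\<lambda>s. f (z + s *\<^sub>R dir i, j)) 0 +
     (\<Sum>\<alpha> | size \<alpha> \<le> k. j (add_mset i \<alpha>) * deriv (\<lambda>s. f (z, j(\<alpha> := s))) (j \<alpha>)))"

definition total_div ::
    "nat \<Rightarrow> ('n::finite \<Rightarrow> 'n jet \<Rightarrow> real) \<Rightarrow> 'n jet \<Rightarrow> real" where
  "total_div k \<phi> w = (\<Sum>i\<in>UNIV. total_deriv k (Some i) (\<phi> i) w)"

(* "Identically" means at all points of the jet space over Z, i.e. for arbitrary values of u and
   its derivatives. *)
definition conservation_law_multiplier ::
    "nat \<Rightarrow> nat \<Rightarrow> 'n::finite spacetime set \<Rightarrow> ('n jet \<Rightarrow> real) \<Rightarrow> ('n jet \<Rightarrow> real) \<Rightarrow>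
      ('n jet \<Rightarrow> real) \<Rightarrow> ('n \<Rightarrow> 'n jet \<Rightarrow> real) \<Rightarrow> bool" where
  "conservation_law_multiplier r d Z F lam \<psi> \<phi> \<longleftrightarrow>
     (let k = max r d - 1 in
       analytic_diff_fun r Z lam \<and>
       analytic_diff_fun k Z \<psi> \<and>
       (\<forall>i. analytic_diff_fun k Z (\<phi> i)) \<and>
       (\<forall>w \<in> Z \<times> UNIV. lam w * F w = total_deriv k None \<psi> w + total_div k \<phi> w))"


section \<open>Meshes and finite difference discretizations\<close>

definition time_mesh :: "real \<Rightarrow> real \<Rightarrow> real set" where
  "time_mesh T \<tau> = {of_int k * \<tau> | k. 0 \<le> k \<and> k \<le> \<lfloor>T / \<tau>\<rfloor>}"

definition space_mesh :: "(real ^ 'n::finite) set \<Rightarrow> real \<Rightarrow> (real ^ 'n) set" where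
  "space_mesh \<Omega> h = \<Omega> \<inter> range (\<lambda>J :: int ^ 'n. \<chi> i. h * of_int (J $ i))"

definition mesh :: "real \<Rightarrow> (real ^ 'n::finite) set \<Rightarrow> real \<Rightarrow> real \<Rightarrow> 'n spacetime set" where
  "mesh T \<Omega> \<tau> h = time_mesh T \<tau> \<times> space_mesh \<Omega> h"

lemma finite_mesh:
  assumes "bounded \<Omega>" and "h > 0"
  shows "finite (mesh T \<Omega> \<tau> h)"
proof -
  have "finite (time_mesh T \<tau>)"
  proof -
    have "time_mesh T \<tau> = (\<lambda>k. of_int k * \<tau>) ` {0..\<lfloor>T / \<tau>\<rfloor>}"
      by (auto simp: time_mesh_def)
    then show ?thesis by simp
  qed
  moreover have "finite (space_mesh \<Omega> h)"
  proof -
    obtain B where B: "\<And>x. x \<in> \<Omega> \<Longrightarrow> norm x \<le> B"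
      using \<open>bounded \<Omega>\<close> by (auto simp: bounded_iff)
    let ?S = "(\<lambda>k. h * of_int k) ` {-\<lceil>B / h\<rceil>..\<lceil>B / h\<rceil>}"
    have "space_mesh \<Omega> h \<subseteq> {x. \<forall>i. x $ i \<in> ?S}"
    proof (clarsimp simp: space_mesh_def)
      fix J :: "int ^ 'a" and i
      assume "(\<chi> i. h * of_int (J $ i)) \<in> \<Omega>"
      then have "\<bar>h * of_int (J $ i)\<bar> \<le> B"
        using B component_le_norm_cart[of "\<chi> i. h * of_int (J $ i)" i] by fastforce
      then have "of_int \<bar>J $ i\<bar> \<le> B / h"
        using \<open>h > 0\<close> by (simp add: abs_mult field_simps)
      then have "\<bar>J $ i\<bar> \<le> \<lceil>B / h\<rceil>" by linarith
      then show "h * of_int (J $ i) \<in> ?S"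
        by (intro image_eqI[where x = "J $ i"]) auto
    qed
    moreover have "finite {x :: real ^ 'a. \<forall>i. x $ i \<in> ?S}"
      by (rule finite_subset[OF _ finite_imageI[OF finite_PiE[of UNIV "\<lambda>_. ?S"], of vec_lambda]])
         (auto simp: image_iff intro!: bexI[where x = "vec_nth _"])
    ultimately show ?thesis by (rule finite_subset)
  qed
  ultimately show ?thesis by (simp add: mesh_def)
qed

(* Maximum over the finite set M; inserting 0 only serves to cover the empty mesh. *)
definition linf_norm :: "'a set \<Rightarrow> ('a \<Rightarrow> real) \<Rightarrow> real" where
  "linf_norm M g = Max (insert 0 ((\<lambda>z. \<bar>g z\<bar>) ` M))"

(* A family of discretizations A \<tau> h maps a discrete function to its values at the mesh points.
   Discrete functions are undefined off the mesh, so that A \<tau> h v z can depend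
   only on z and the mesh values of v. *)
type_synonym 'n discretization =
  "real \<Rightarrow> real \<Rightarrow> ('n spacetime \<Rightarrow> real) \<Rightarrow> 'n spacetime \<Rightarrow> real"

definition discrete_functions ::
    "real \<Rightarrow> (real ^ 'n::finite) set \<Rightarrow> real \<Rightarrow> real \<Rightarrow> ('n spacetime \<Rightarrow> real) set" where
  "discrete_functions T \<Omega> \<tau> h = mesh T \<Omega> \<tau> h \<rightarrow>\<^sub>E UNIV"

definition mesh_values ::
    "real \<Rightarrow> (real ^ 'n::finite) set \<Rightarrow> real \<Rightarrow> real \<Rightarrow> ('n spacetime \<Rightarrow> real) \<Rightarrow> 'n spacetime \<Rightarrow> real"
  where "mesh_values T \<Omega> \<tau> h u = restrict u (mesh T \<Omega> \<tau> h)"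

definition multiplier_discretization ::
    "'n::finite discretization \<Rightarrow> 'n discretization \<Rightarrow> 'n discretization \<Rightarrow> 'n discretization" where
  "multiplier_discretization lamh Dth Dxh \<tau> h v z =
     inverse (lamh \<tau> h v z) * (Dth \<tau> h v z + Dxh \<tau> h v z)"

end

theory Submission
  imports Defs
begin

text \<open>
  Accuracy of the multiplier discretization is a matter of algebra plus one a priori bound. Since
  \<open>\<lambda>F = D_t \<psi> + D_x\<cdot>\<phi>\<close> holds identically on the jet space, it holds along the jet of \<open>u\<close>, and therefore
  \<open>F - F_h = \<lambda>_h\<inverse> ((\<lambda>_h - \<lambda>) F + (D_t \<psi> - D_t_h \<psi>) + (D_x\<cdot>\<phi> - D_x_h\<cdot>\<phi>))\<close>
  at every mesh point, whether or not \<open>u\<close> solves the equation. The three differences are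
  of order \<open>h^p + \<tau>^q\<close> and \<open>\<lambda>_h\<inverse>\<close> is bounded by \<open>\<gamma>\<close> (\<open>quotient_error_bound\<close>); division is only
  by the discrete multiplier, so zeros of \<open>\<lambda>\<close> itself do no harm.

  The remaining factor \<open>F\<close> has to be bounded along \<open>u\<close> uniformly in the mesh
  (\<open>pde_bounded_along_function\<close>). The derivatives of \<open>u\<close> that \<open>F\<close> uses extend continuously to the
  closure of the cylinder, which is compact and contains every mesh, so \<open>F[u]\<close> agrees there with a
  continuous function on a compact set.
\<close>

lemma linf_norm_le_iff:
  assumes "finite M"
  shows "linf_norm M g \<le> c \<longleftrightarrow> 0 \<le> c \<and> (\<forall>z\<in>M. \<bar>g z\<bar> \<le> c)"
  using assms by (simp add: linf_norm_def)

text \<open>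
  The initial layer \<open>t = 0\<close>, and the final one when \<open>\<tau>\<close> divides \<open>T\<close>, belong to the mesh. This is
  why the derivatives are needed up to the boundary in time, not only in the open cylinder.
\<close>

lemma mesh_subset_cylinder:
  assumes "\<tau> > 0"
  shows "mesh T \<Omega> \<tau> h \<subseteq> {0..T} \<times> \<Omega>"
proof -
  have "of_int k * \<tau> \<le> T" if "k \<le> \<lfloor>T / \<tau>\<rfloor>" for k
    using that assms by (simp add: le_floor_iff field_simps)
  then show ?thesis
    using assms by (auto simp: mesh_def time_mesh_def space_mesh_def)
qed

text \<open>
  A point of the closure of an open set is always a limit of other points of the set, so the limit
  that defines the boundary value of a derivative is taken along a nontrivial filter and returns
  the continuous extension, at interior points as well.
\<close>

lemma continuous_on_partial_closure:
  fixes S :: "'n::finite spacetime set"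
  assumes "open S" and "Ck_closure k S u" and "size \<alpha> \<le> k"
  shows "continuous_on (closure S) (partial_closure S \<alpha> u)"
proof -
  define ds where "ds = (SOME is. mset is = \<alpha>)"
  have "mset ds = \<alpha>"
    unfolding ds_def by (rule someI_ex) (rule ex_mset)
  then have "length ds \<le> k"
    using assms(3) by (metis size_mset)
  then obtain g where g: "continuous_on (closure S) g" "\<And>z. z \<in> S \<Longrightarrow> g z = partials ds u z"
    using assms(2) unfolding Ck_closure_def by blast
  have "partial_closure S \<alpha> u z = g z" if z: "z \<in> closure S" for z
  proof -
    have "z islimpt S"
      using z \<open>open S\<close> by (metis closure_def UnE interior_limit_point interior_open mem_Collect_eq)
    then have nontrivial: "at z within S \<noteq> bot"
      by (simp add: trivial_limit_within)
    have "(g \<longlongrightarrow> g z) (at z within S)"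
      using g(1) z closure_subset[of S] by (meson continuous_on_def tendsto_within_subset)
    then have "(partials ds u \<longlongrightarrow> g z) (at z within S)"
      by (rule Lim_transform_eventually) (auto simp: eventually_at_topological g(2))
    then show ?thesis
      unfolding partial_closure_def ds_def[symmetric] by (rule tendsto_Lim[OF nontrivial])
  qed
  then show ?thesis
    using g(1) by (simp cong: continuous_on_cong)
qed

lemma pde_bounded_along_function:
  fixes S :: "'n::finite spacetime set"
  assumes "open S" and "bounded S" and "Ck_closure k S u" and "d \<le> k"
    and F: "pde_of_order d (closure S) F"
  obtains B where "B \<ge> 0" and "\<And>z. z \<in> closure S \<Longrightarrow> \<bar>F (jet_of S u z)\<bar> \<le> B"
proof -
  \<comment> \<open>Derivatives of higher order than the smoothness of u need not exist, so the jet itself may be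
    discontinuous; truncating it at the order of F does not change the value of F.\<close>
  define J where
    "J z = (z, \<lambda>\<alpha>. if size \<alpha> \<le> d then partial_closure S \<alpha> u z else 0)" for z
  have "continuous_on (closure S)
      (\<lambda>z. if size \<alpha> \<le> d then partial_closure S \<alpha> u z else 0)" for \<alpha>
    using continuous_on_partial_closure[OF assms(1,3), of \<alpha>] \<open>d \<le> k\<close> by (cases "size \<alpha> \<le> d") auto
  then have cont_J: "continuous_on (closure S) J"
    unfolding J_def
    by (intro continuous_on_Pair continuous_on_id continuous_on_coordinatewise_then_product)
  have "continuous_on (closure S \<times> UNIV) F"
    using F by (simp add: pde_of_order_def)
  then have "continuous_on (closure S) (\<lambda>z. F (J z))"
    by (rule continuous_on_compose2[OF _ cont_J]) (auto simp: J_def)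
  moreover have "compact (closure S)"
    using \<open>bounded S\<close> by (simp add: compact_closure)
  ultimately have "bounded ((\<lambda>z. F (J z)) ` closure S)"
    by (intro compact_imp_bounded compact_continuous_image)
  then obtain B where B: "B > 0" "\<And>z. z \<in> closure S \<Longrightarrow> \<bar>F (J z)\<bar> \<le> B"
    by (auto simp: bounded_pos)
  have order: "F (z, j) = F (z, j')" if "\<And>\<alpha>. size \<alpha> \<le> d \<Longrightarrow> j \<alpha> = j' \<alpha>" for z j j'
    using F that unfolding pde_of_order_def jet_order_le_def by metis
  have "F (jet_of S u z) = F (J z)" for z
    unfolding J_def jet_of_def by (rule order) simp
  with B show ?thesis
    using that[of B] by simp
qed

text \<open>
  Here \<open>l\<close>, \<open>a\<close>, \<open>b\<close> stand for the values at one mesh point of the multiplier and of the two parts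
  of the divergence, primes for their discretizations. Expanding \<open>l' f - a' - b'\<close> around \<open>l f = a + b\<close> leaves one
  error term for each of the three, and only the first is multiplied by \<open>f\<close>.
\<close>

lemma quotient_error_bound:
  fixes f l l' :: real
  assumes identity: "l * f = a + b" and "l' \<noteq> 0"
    and "\<bar>inverse l'\<bar> \<le> \<gamma>" and "\<bar>f\<bar> \<le> B"
    and "\<bar>l - l'\<bar> \<le> \<epsilon>" and "\<bar>a - a'\<bar> \<le> \<epsilon>\<^sub>a" and "\<bar>b - b'\<bar> \<le> \<epsilon>\<^sub>b"
  shows "\<bar>f - inverse l' * (a' + b')\<bar> \<le> \<gamma> * (\<epsilon> * B + \<epsilon>\<^sub>a + \<epsilon>\<^sub>b)"
proof -
  have "f - inverse l' * (a' + b') = inverse l' * (l' * f - (a' + b'))"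
    using \<open>l' \<noteq> 0\<close> by (simp add: field_simps)
  also have "l' * f - (a' + b') = (a - a') + (b - b') - (l - l') * f"
    using identity by (simp add: algebra_simps)
  finally have "\<bar>f - inverse l' * (a' + b')\<bar>
      = \<bar>inverse l'\<bar> * \<bar>(a - a') + (b - b') - (l - l') * f\<bar>"
    by (simp add: abs_mult)
  also have "\<dots> \<le> \<gamma> * (\<epsilon> * B + \<epsilon>\<^sub>a + \<epsilon>\<^sub>b)"
  proof (rule mult_mono)
    have "\<bar>(l - l') * f\<bar> \<le> \<epsilon> * B"
      using assms by (simp add: abs_mult mult_mono)
    then show "\<bar>(a - a') + (b - b') - (l - l') * f\<bar> \<le> \<epsilon> * B + \<epsilon>\<^sub>a + \<epsilon>\<^sub>b"
      using assms by linarith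
    show "0 \<le> \<gamma>"
      using assms(3) by linarith
  qed (use assms(3) in simp_all)
  finally show ?thesis .
qed

theorem theorem2:
  fixes T :: real and \<Omega> :: "(real ^ 'n::finite) set"
    and d r p q :: nat
    and F lam \<psi> :: "'n jet \<Rightarrow> real" and \<phi> :: "'n \<Rightarrow> 'n jet \<Rightarrow> real"
    and u :: "'n spacetime \<Rightarrow> real"
    and sizes :: "(real \<times> real) set"
    and lamh Dth Dxh :: "'n discretization"
    and adm :: "real \<Rightarrow> real \<Rightarrow> ('n spacetime \<Rightarrow> real) set"
    and C_lam C_t C_x \<gamma> :: real
  defines "S \<equiv> {0<..<T} \<times> \<Omega>"
  assumes T: "T > 0"
    and domain: "open \<Omega>" "connected \<Omega>" "bounded \<Omega>" "\<Omega> \<noteq> {}"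
    and pde: "pde_of_order d (closure S) F"
    and u: "Ck_closure (max p q + max r d) S u"
    and multiplier: "conservation_law_multiplier r d ({0..T} \<times> \<Omega>) F lam \<psi> \<phi>"
    and sizes: "\<And>\<tau> h. (\<tau>, h) \<in> sizes \<Longrightarrow> \<tau> > 0 \<and> h > 0"
    and acc_lam: "\<And>\<tau> h. (\<tau>, h) \<in> sizes \<Longrightarrow>
      linf_norm (mesh T \<Omega> \<tau> h)
        (\<lambda>z. lam (jet_of S u z) - lamh \<tau> h (mesh_values T \<Omega> \<tau> h u) z) \<le> C_lam * (h ^ p + \<tau> ^ q)"
    and acc_t: "\<And>\<tau> h. (\<tau>, h) \<in> sizes \<Longrightarrow>
      linf_norm (mesh T \<Omega> \<tau> h)
        (\<lambda>z. total_deriv (max r d - 1) None \<psi> (jet_of S u z)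
              - Dth \<tau> h (mesh_values T \<Omega> \<tau> h u) z) \<le> C_t * (h ^ p + \<tau> ^ q)"
    and acc_x: "\<And>\<tau> h. (\<tau>, h) \<in> sizes \<Longrightarrow>
      linf_norm (mesh T \<Omega> \<tau> h)
        (\<lambda>z. total_div (max r d - 1) \<phi> (jet_of S u z)
              - Dxh \<tau> h (mesh_values T \<Omega> \<tau> h u) z) \<le> C_x * (h ^ p + \<tau> ^ q)"
    and adm: "\<And>\<tau> h. (\<tau>, h) \<in> sizes \<Longrightarrow>
      adm \<tau> h \<subseteq> discrete_functions T \<Omega> \<tau> h \<and> mesh_values T \<Omega> \<tau> h u \<in> adm \<tau> h"
    and inv_exists: "\<And>\<tau> h uh z. \<lbrakk>(\<tau>, h) \<in> sizes; uh \<in> adm \<tau> h; z \<in> mesh T \<Omega> \<tau> h\<rbrakk> \<Longrightarrow>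
      lamh \<tau> h uh z \<noteq> 0"
    and inv_bound: "\<And>\<tau> h uh. \<lbrakk>(\<tau>, h) \<in> sizes; uh \<in> adm \<tau> h\<rbrakk> \<Longrightarrow>
      linf_norm (mesh T \<Omega> \<tau> h) (\<lambda>z. inverse (lamh \<tau> h uh z)) \<le> \<gamma>"
  shows "\<exists>C>0. \<forall>(\<tau>, h) \<in> sizes.
      linf_norm (mesh T \<Omega> \<tau> h)
        (\<lambda>z. F (jet_of S u z)
              - multiplier_discretization lamh Dth Dxh \<tau> h (mesh_values T \<Omega> \<tau> h u) z)
      \<le> C * (h ^ p + \<tau> ^ q)"
proof -
  have "open S"
    unfolding S_def using domain by (simp add: open_Times)
  have "bounded S"
    unfolding S_def using domain by (simp add: bounded_Times)
  have cylinder: "{0..T} \<times> \<Omega> \<subseteq> closure S"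
    using T closure_subset[of \<Omega>] by (auto simp: S_def closure_Times)
  obtain B where "B \<ge> 0" and B: "\<And>z. z \<in> closure S \<Longrightarrow> \<bar>F (jet_of S u z)\<bar> \<le> B"
    using pde_bounded_along_function[OF \<open>open S\<close> \<open>bounded S\<close> u _ pde] max.cobounded2 trans_le_add2
    by metis
  \<comment> \<open>The given constants may be negative when there are no mesh sizes, and all of them may vanish;
    absolute values and the summand 1 make C positive in every case.\<close>
  define C where "C = \<bar>\<gamma> * (C_lam * B + C_t + C_x)\<bar> + 1"
  have "linf_norm (mesh T \<Omega> \<tau> h)
        (\<lambda>z. F (jet_of S u z)
              - multiplier_discretization lamh Dth Dxh \<tau> h (mesh_values T \<Omega> \<tau> h u) z)
      \<le> C * (h ^ p + \<tau> ^ q)" if in_sizes: "(\<tau>, h) \<in> sizes" for \<tau> h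
  proof -
    let ?M = "mesh T \<Omega> \<tau> h" and ?v = "mesh_values T \<Omega> \<tau> h u" and ?e = "h ^ p + \<tau> ^ q"
    have pos: "\<tau> > 0" "h > 0" and admissible: "?v \<in> adm \<tau> h"
      using sizes[OF in_sizes] adm[OF in_sizes] by auto
    have fin: "finite ?M"
      using domain(3) pos(2) by (rule finite_mesh)
    note pointwise = linf_norm_le_iff[OF fin]
    have "?e > 0"
      using pos by (simp add: add_pos_pos)
    have "\<gamma> * (C_lam * B + C_t + C_x) \<le> C"
      by (simp add: C_def)
    then have C: "\<gamma> * (C_lam * ?e * B + C_t * ?e + C_x * ?e) \<le> C * ?e"
      using mult_right_mono[of _ C ?e] \<open>?e > 0\<close> by (fastforce simp: algebra_simps)
    have "\<bar>F (jet_of S u z) - multiplier_discretization lamh Dth Dxh \<tau> h ?v z\<bar> \<le> C * ?e"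
      if z: "z \<in> ?M" for z
    proof -
      let ?w = "jet_of S u z"
      have z_cyl: "z \<in> {0..T} \<times> \<Omega>"
        using mesh_subset_cylinder[OF pos(1)] z by blast
      then have w: "?w \<in> ({0..T} \<times> \<Omega>) \<times> UNIV"
        by (simp add: jet_of_def)
      have "lam ?w * F ?w
          = total_deriv (max r d - 1) None \<psi> ?w + total_div (max r d - 1) \<phi> ?w"
        using multiplier w unfolding conservation_law_multiplier_def Let_def by metis
      then have "\<bar>F ?w - multiplier_discretization lamh Dth Dxh \<tau> h ?v z\<bar>
          \<le> \<gamma> * (C_lam * ?e * B + C_t * ?e + C_x * ?e)"
        unfolding multiplier_discretization_def
      proof (rule quotient_error_bound)
        show "lamh \<tau> h ?v z \<noteq> 0"
          using inv_exists[OF in_sizes admissible z] .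
        show "\<bar>inverse (lamh \<tau> h ?v z)\<bar> \<le> \<gamma>"
          using inv_bound[OF in_sizes admissible] z unfolding pointwise by blast
        show "\<bar>F ?w\<bar> \<le> B"
          using B cylinder z_cyl by blast
      qed (use acc_lam[OF in_sizes] acc_t[OF in_sizes] acc_x[OF in_sizes] z
            in \<open>unfold pointwise, blast\<close>)+
      with C show ?thesis by linarith
    qed
    moreover have "0 \<le> C * ?e"
      using \<open>?e > 0\<close> by (simp add: C_def)
    ultimately show ?thesis
      unfolding pointwise by blast
  qed
  moreover have "C > 0"
    by (simp add: C_def)
  ultimately show ?thesis by blast
qed

end
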